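(* Let $(H,m_{H},\Phi_{H})$ be a weak twisted post-Hopf algebra in a strict braided monoidal category $\mathsf{C}$ such that $\Phi_{H}\circ\eta_{H}=\eta_{H}$. Then $\Phi_{H}$ is idempotent, i.e. $\Phi_H\circ\Phi_H=\Phi_H$.
   Context: $\mathsf{C}=(\mathsf{C},\otimes,K,c)$ is a strict braided monoidal category with unit object $K$ and braiding $c_{M,N}\colon M\otimes N\to N\otimes M$. For an object $X$ and a morphism $f$, $X\otimes f$ and $f\otimes X$ denote $\mathrm{id}_X\otimes f$ and $f\otimes \mathrm{id}_X$. A Hopf algebra in $\mathsf{C}$ is $H=(H,\eta_H,\mu_H,\varepsilon_H,\delta_H,\lambda_H)$ (unit, product, counit, coproduct, antipode). The coalgebra $H\otimes H$ has coproduct $(H\otimes c_{H,H}\otimes H)\circ(\delta_H\otimes\delta_H)$ and counit $\varepsilon_H\otimes\varepsilon_H$. Weak twisted post-Hopf algebra: a triple $(H,m_H,\Phi_H)$ with $H$ a Hopf algebra in $\mathsf{C}$ and morphisms $m_H\colon H\otimes H\to H$, $\Phi_H\colon H\to H$ such that: (i) $m_H$ is a coalgebra morphism; (ii) $\Phi_H$ is a coalgebra morphism; (iii) $\Phi_{H}\circ\mu_{H}\circ(\Phi_{H}\otimes m_{H})\circ(\delta_{H}\otimes H)=\mu_{H}\circ(\Phi_{H}\otimes m_{H})\circ(\delta_{H}\otimes \Phi_{H})$; (iv) $m_{H}\circ(H\otimes m_{H})=m_{H}\circ((\mu_{H}\circ(\Phi_{H}\otimes m_{H})\circ(\delta_{H}\otimes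 H))\otimes H)$; (v) $m_{H}\circ(H\otimes\mu_{H})=\mu_{H}\circ(m_{H}\otimes m_{H})\circ(H\otimes c_{H,H}\otimes H)\circ(\delta_{H}\otimes H\otimes H)$. *)

theory Defs
  imports Main
begin

text \<open>
  A category is given by a set of objects and a set of arrows, each arrow having a domain
  and a codomain. All operations are total HOL functions whose values outside these sets,
  or on non-composable pairs, are irrelevant.
\<close>

record ('o, 'm) braided_cat =
  Obj :: "'o set"
  Arr :: "'m set"
  dom :: "'m \<Rightarrow> 'o"
  cod :: "'m \<Rightarrow> 'o"
  ide :: "'o \<Rightarrow> 'm"  ("\<one>\<index>")
  comp :: "'m \<Rightarrow> 'm \<Rightarrow> 'm"  (infixl "\<cdot>\<index>" 65)
  unit_obj :: "'o"  ("\<K>\<index>")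
  tensor_obj :: "'o \<Rightarrow> 'o \<Rightarrow> 'o"  (infixl "\<otimes>\<^sub>o\<index>" 75)
  tensor :: "'m \<Rightarrow> 'm \<Rightarrow> 'm"  (infixl "\<otimes>\<index>" 70)
  braid :: "'o \<Rightarrow> 'o \<Rightarrow> 'm"  ("\<c>\<index>")

definition hom :: "('o, 'm, 'z) braided_cat_scheme \<Rightarrow> 'o \<Rightarrow> 'o \<Rightarrow> 'm set"  ("Hom\<index>") where
  "hom C A B = {f \<in> Arr C. dom C f = A \<and> cod C f = B}"

locale category =
  fixes C :: "('o, 'm, 'z) braided_cat_scheme" (structure)
  assumes dom_closed: "f \<in> Arr C \<Longrightarrow> dom C f \<in> Obj C"
    and cod_closed: "f \<in> Arr C \<Longrightarrow> cod C f \<in> Obj C"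
    and ide_closed: "A \<in> Obj C \<Longrightarrow> \<one> A \<in> Hom A A"
    and comp_closed: "f \<in> Hom A B \<Longrightarrow> g \<in> Hom B D \<Longrightarrow> g \<cdot> f \<in> Hom A D"
    and ide_left: "f \<in> Hom A B \<Longrightarrow> \<one> B \<cdot> f = f"
    and ide_right: "f \<in> Hom A B \<Longrightarrow> f \<cdot> \<one> A = f"
    and comp_assoc:
      "f \<in> Hom A B \<Longrightarrow> g \<in> Hom B D \<Longrightarrow> h \<in> Hom D E \<Longrightarrow> (h \<cdot> g) \<cdot> f = h \<cdot> (g \<cdot> f)"
begin

definition iso :: "'m \<Rightarrow> bool" where
  "iso f \<longleftrightarrow> (\<exists>A B g. f \<in> Hom A B \<and> g \<in> Hom B A \<and> g \<cdot> f = \<one> A \<and> f \<cdot> g = \<one> B)"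

end

locale strict_monoidal_category = category C
  for C :: "('o, 'm, 'z) braided_cat_scheme" (structure) +
  assumes unit_obj_closed: "\<K> \<in> Obj C"
    and tensor_obj_closed: "A \<in> Obj C \<Longrightarrow> B \<in> Obj C \<Longrightarrow> A \<otimes>\<^sub>o B \<in> Obj C"
    and tensor_closed:
      "f \<in> Hom A B \<Longrightarrow> g \<in> Hom A' B' \<Longrightarrow> f \<otimes> g \<in> Hom (A \<otimes>\<^sub>o A') (B \<otimes>\<^sub>o B')"
    and tensor_ide: "A \<in> Obj C \<Longrightarrow> B \<in> Obj C \<Longrightarrow> \<one> A \<otimes> \<one> B = \<one> (A \<otimes>\<^sub>o B)"
    and tensor_comp:
      "f \<in> Hom A B \<Longrightarrow> g \<in> Hom B D \<Longrightarrow> f' \<in> Hom A' B' \<Longrightarrow> g' \<in> Hom B' D' \<Longrightarrow>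
        (g \<cdot> f) \<otimes> (g' \<cdot> f') = (g \<otimes> g') \<cdot> (f \<otimes> f')"
    and tensor_obj_assoc:
      "A \<in> Obj C \<Longrightarrow> B \<in> Obj C \<Longrightarrow> D \<in> Obj C \<Longrightarrow> (A \<otimes>\<^sub>o B) \<otimes>\<^sub>o D = A \<otimes>\<^sub>o (B \<otimes>\<^sub>o D)"
    and tensor_obj_unit_left: "A \<in> Obj C \<Longrightarrow> \<K> \<otimes>\<^sub>o A = A"
    and tensor_obj_unit_right: "A \<in> Obj C \<Longrightarrow> A \<otimes>\<^sub>o \<K> = A"
    and tensor_assoc:
      "f \<in> Arr C \<Longrightarrow> g \<in> Arr C \<Longrightarrow> h \<in> Arr C \<Longrightarrow> (f \<otimes> g) \<otimes> h = f \<otimes> (g \<otimes> h)"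
    and tensor_unit_left: "f \<in> Arr C \<Longrightarrow> \<one> \<K> \<otimes> f = f"
    and tensor_unit_right: "f \<in> Arr C \<Longrightarrow> f \<otimes> \<one> \<K> = f"

locale strict_braided_monoidal_category = strict_monoidal_category C
  for C :: "('o, 'm, 'z) braided_cat_scheme" (structure) +
  assumes braid_closed:
      "M \<in> Obj C \<Longrightarrow> N \<in> Obj C \<Longrightarrow> \<c> M N \<in> Hom (M \<otimes>\<^sub>o N) (N \<otimes>\<^sub>o M)"
    and braid_iso: "M \<in> Obj C \<Longrightarrow> N \<in> Obj C \<Longrightarrow> iso (\<c> M N)"
    and braid_natural:
      "f \<in> Hom M M' \<Longrightarrow> g \<in> Hom N N' \<Longrightarrow> (g \<otimes> f) \<cdot> \<c> M N = \<c> M' N' \<cdot> (f \<otimes> g)"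
    and hexagon_right:
      "M \<in> Obj C \<Longrightarrow> N \<in> Obj C \<Longrightarrow> P \<in> Obj C \<Longrightarrow>
        \<c> M (N \<otimes>\<^sub>o P) = (\<one> N \<otimes> \<c> M P) \<cdot> (\<c> M N \<otimes> \<one> P)"
    and hexagon_left:
      "M \<in> Obj C \<Longrightarrow> N \<in> Obj C \<Longrightarrow> P \<in> Obj C \<Longrightarrow>
        \<c> (M \<otimes>\<^sub>o N) P = (\<c> M P \<otimes> \<one> N) \<cdot> (\<one> M \<otimes> \<c> N P)"

record ('o, 'm) coalg =
  carrier_obj :: "'o"
  counit :: "'m"  ("\<epsilon>\<index>")
  coproduct :: "'m"  ("\<delta>\<index>")

record ('o, 'm) hopf_alg = "('o, 'm) coalg" +
  unit_mor :: "'m"  ("\<eta>\<index>")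
  product :: "'m"  ("\<mu>\<index>")
  antipode :: "'m"  ("\<lambda>\<^sub>S\<index>")

context strict_braided_monoidal_category
begin

definition coalgebra :: "('o, 'm, 'y) coalg_scheme \<Rightarrow> bool" where
  "coalgebra A \<longleftrightarrow>
    (let X = carrier_obj A in
      X \<in> Obj C \<and> \<epsilon>\<^bsub>A\<^esub> \<in> Hom X \<K> \<and> \<delta>\<^bsub>A\<^esub> \<in> Hom X (X \<otimes>\<^sub>o X) \<and>
      (\<epsilon>\<^bsub>A\<^esub> \<otimes> \<one> X) \<cdot> \<delta>\<^bsub>A\<^esub> = \<one> X \<and>
      (\<one> X \<otimes> \<epsilon>\<^bsub>A\<^esub>) \<cdot> \<delta>\<^bsub>A\<^esub> = \<one> X \<and>
      (\<delta>\<^bsub>A\<^esub> \<otimes> \<one> X) \<cdot> \<delta>\<^bsub>A\<^esub> = (\<one> X \<otimes> \<delta>\<^bsub>A\<^esub>) \<cdot> \<delta>\<^bsub>A\<^esub>)"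

definition coalgebra_morphism ::
    "('o, 'm, 'y) coalg_scheme \<Rightarrow> ('o, 'm, 'w) coalg_scheme \<Rightarrow> 'm \<Rightarrow> bool" where
  "coalgebra_morphism A B f \<longleftrightarrow>
    f \<in> Hom (carrier_obj A) (carrier_obj B) \<and>
    \<epsilon>\<^bsub>B\<^esub> \<cdot> f = \<epsilon>\<^bsub>A\<^esub> \<and> \<delta>\<^bsub>B\<^esub> \<cdot> f = (f \<otimes> f) \<cdot> \<delta>\<^bsub>A\<^esub>"

text \<open>By strictness \<open>K \<otimes> K = K\<close>, so the coproduct of the unit coalgebra is the identity.\<close>

definition unit_coalgebra :: "('o, 'm) coalg" where
  "unit_coalgebra = \<lparr>carrier_obj = \<K>, counit = \<one> \<K>, coproduct = \<one> \<K>\<rparr>"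

definition tensor_coalgebra ::
    "('o, 'm, 'y) coalg_scheme \<Rightarrow> ('o, 'm, 'w) coalg_scheme \<Rightarrow> ('o, 'm) coalg" where
  "tensor_coalgebra A B =
    \<lparr>carrier_obj = carrier_obj A \<otimes>\<^sub>o carrier_obj B,
     counit = \<epsilon>\<^bsub>A\<^esub> \<otimes> \<epsilon>\<^bsub>B\<^esub>,
     coproduct =
       (\<one> (carrier_obj A) \<otimes> \<c> (carrier_obj A) (carrier_obj B) \<otimes> \<one> (carrier_obj B))
         \<cdot> (\<delta>\<^bsub>A\<^esub> \<otimes> \<delta>\<^bsub>B\<^esub>)\<rparr>"

definition algebra :: "('o, 'm, 'y) hopf_alg_scheme \<Rightarrow> bool" where
  "algebra A \<longleftrightarrow>
    (let X = carrier_obj A in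
      X \<in> Obj C \<and> \<eta>\<^bsub>A\<^esub> \<in> Hom \<K> X \<and> \<mu>\<^bsub>A\<^esub> \<in> Hom (X \<otimes>\<^sub>o X) X \<and>
      \<mu>\<^bsub>A\<^esub> \<cdot> (\<eta>\<^bsub>A\<^esub> \<otimes> \<one> X) = \<one> X \<and>
      \<mu>\<^bsub>A\<^esub> \<cdot> (\<one> X \<otimes> \<eta>\<^bsub>A\<^esub>) = \<one> X \<and>
      \<mu>\<^bsub>A\<^esub> \<cdot> (\<mu>\<^bsub>A\<^esub> \<otimes> \<one> X) = \<mu>\<^bsub>A\<^esub> \<cdot> (\<one> X \<otimes> \<mu>\<^bsub>A\<^esub>))"

end

text \<open>
  The last two assumptions say that the antipode is inverse to the identity for the
  convolution product.
\<close>

locale hopf_algebra = strict_braided_monoidal_category C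
  for C :: "('o, 'm, 'z) braided_cat_scheme" (structure) +
  fixes H :: "('o, 'm, 'y) hopf_alg_scheme"
  assumes algebra: "algebra H"
    and coalgebra: "coalgebra H"
    and unit_mor_coalgebra_morphism: "coalgebra_morphism unit_coalgebra H \<eta>\<^bsub>H\<^esub>"
    and product_coalgebra_morphism: "coalgebra_morphism (tensor_coalgebra H H) H \<mu>\<^bsub>H\<^esub>"
    and antipode_closed: "\<lambda>\<^sub>S\<^bsub>H\<^esub> \<in> Hom (carrier_obj H) (carrier_obj H)"
    and antipode_right:
      "\<mu>\<^bsub>H\<^esub> \<cdot> (\<one> (carrier_obj H) \<otimes> \<lambda>\<^sub>S\<^bsub>H\<^esub>) \<cdot> \<delta>\<^bsub>H\<^esub> = \<eta>\<^bsub>H\<^esub> \<cdot> \<epsilon>\<^bsub>H\<^esub>"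
    and antipode_left:
      "\<mu>\<^bsub>H\<^esub> \<cdot> (\<lambda>\<^sub>S\<^bsub>H\<^esub> \<otimes> \<one> (carrier_obj H)) \<cdot> \<delta>\<^bsub>H\<^esub> = \<eta>\<^bsub>H\<^esub> \<cdot> \<epsilon>\<^bsub>H\<^esub>"

locale weak_twisted_post_hopf_algebra = hopf_algebra C H
  for C :: "('o, 'm, 'z) braided_cat_scheme" (structure)
    and H :: "('o, 'm, 'y) hopf_alg_scheme" +
  fixes m :: "'m" and \<Phi> :: "'m"
  assumes m_coalgebra_morphism: "coalgebra_morphism (tensor_coalgebra H H) H m"
    and \<Phi>_coalgebra_morphism: "coalgebra_morphism H H \<Phi>"
    and \<Phi>_weighted_product:
      "\<Phi> \<cdot> \<mu>\<^bsub>H\<^esub> \<cdot> (\<Phi> \<otimes> m) \<cdot> (\<delta>\<^bsub>H\<^esub> \<otimes> \<one> (carrier_obj H))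
        = \<mu>\<^bsub>H\<^esub> \<cdot> (\<Phi> \<otimes> m) \<cdot> (\<delta>\<^bsub>H\<^esub> \<otimes> \<Phi>)"
    and m_weighted_assoc:
      "m \<cdot> (\<one> (carrier_obj H) \<otimes> m)
        = m \<cdot> ((\<mu>\<^bsub>H\<^esub> \<cdot> (\<Phi> \<otimes> m) \<cdot> (\<delta>\<^bsub>H\<^esub> \<otimes> \<one> (carrier_obj H))) \<otimes> \<one> (carrier_obj H))"
    and m_product:
      "m \<cdot> (\<one> (carrier_obj H) \<otimes> \<mu>\<^bsub>H\<^esub>)
        = \<mu>\<^bsub>H\<^esub> \<cdot> (m \<otimes> m)
          \<cdot> (\<one> (carrier_obj H) \<otimes> \<c> (carrier_obj H) (carrier_obj H) \<otimes> \<one> (carrier_obj H))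
          \<cdot> (\<delta>\<^bsub>H\<^esub> \<otimes> \<one> (carrier_obj H) \<otimes> \<one> (carrier_obj H))"

end

theory Submission
  imports Defs
begin

text \<open>
  In Sweedler notation, the compatibility of \<open>\<Phi>\<close> with the weighted product reads
  \<open>\<Phi> (\<Phi> h\<^sub>1 \<sqdot> m (h\<^sub>2, g)) = \<Phi> h\<^sub>1 \<sqdot> m (h\<^sub>2, \<Phi> g)\<close>. For \<open>g = 1\<close>, since \<open>\<Phi> 1 = 1\<close>, the result is
  \<open>\<Phi> (\<Phi> h\<^sub>1 \<sqdot> m (h\<^sub>2, 1)) = \<Phi> h\<^sub>1 \<sqdot> m (h\<^sub>2, 1)\<close>, which is \<open>\<Phi> (\<Phi> h) = \<Phi> h\<close> as soon as
  \<open>m (h, 1) = \<epsilon> h \<sqdot> 1\<close>.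

  To see the latter, let \<open>e h = m (h, 1)\<close>. The compatibility of \<open>m\<close> with the product shows that
  \<open>e\<close> is idempotent for the convolution product (\<open>act_unit_conv_idem\<close>). As \<open>m\<close> and the unit are
  coalgebra morphisms, so is \<open>e\<close> (\<open>coproduct_act_unit\<close>, \<open>counit_act_unit\<close>), and therefore
  \<open>antipode \<circ> e\<close> is a right convolution inverse of \<open>e\<close> (\<open>conv_antipode\<close>). An idempotent with a right
  inverse is the identity of the convolution monoid, that is, \<open>e = \<eta> \<circ> \<epsilon>\<close> (\<open>act_unit_eq\<close>).

  The braiding enters only through its naturality and the triviality of the braiding with the unit
  object (\<open>braid_unit_right\<close>), which follows from the hexagon and invertibility.
\<close>

section \<open>Calculus of arrows in a strict braided monoidal category\<close>

context category
begin

lemma homD: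
  assumes "f \<in> Hom A B"
  shows "f \<in> Arr C" "dom C f = A" "cod C f = B" "A \<in> Obj C" "B \<in> Obj C"
  using assms dom_closed cod_closed unfolding hom_def by auto

lemma hom_self: "f \<in> Arr C \<Longrightarrow> f \<in> Hom (dom C f) (cod C f)"
  by (simp add: hom_def)

lemma arr_comp:
  assumes "f \<in> Arr C" "g \<in> Arr C" "cod C f = dom C g"
  shows "g \<cdot> f \<in> Arr C" "dom C (g \<cdot> f) = dom C f" "cod C (g \<cdot> f) = cod C g"
  using comp_closed[of f "dom C f" "cod C f" g "cod C g"] assms by (auto simp: hom_def)

lemma arr_ide:
  assumes "A \<in> Obj C"
  shows "\<one> A \<in> Arr C" "dom C (\<one> A) = A" "cod C (\<one> A) = A"
  using ide_closed[OF assms] by (auto simp: hom_def)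

lemma comp_ide_arr:
  assumes "f \<in> Arr C"
  shows "cod C f = A \<Longrightarrow> \<one> A \<cdot> f = f" "dom C f = A \<Longrightarrow> f \<cdot> \<one> A = f"
  using ide_left ide_right hom_self[OF assms] by auto

lemma comp_assoc_arr:
  assumes "f \<in> Arr C" "g \<in> Arr C" "h \<in> Arr C" "cod C f = dom C g" "cod C g = dom C h"
  shows "(h \<cdot> g) \<cdot> f = h \<cdot> (g \<cdot> f)"
  using comp_assoc[of f "dom C f" "cod C f" g "cod C g" h "cod C h"] assms by (auto simp: hom_def)

end

context strict_monoidal_category
begin

lemma arr_tensor:
  assumes "f \<in> Arr C" "g \<in> Arr C"
  shows "f \<otimes> g \<in> Arr C" "dom C (f \<otimes> g) = dom C f \<otimes>\<^sub>o dom C g"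
    "cod C (f \<otimes> g) = cod C f \<otimes>\<^sub>o cod C g"
  using tensor_closed[OF hom_self[OF assms(1)] hom_self[OF assms(2)]] by (auto simp: hom_def)

lemma interchange:
  assumes "f \<in> Arr C" "g \<in> Arr C" "f' \<in> Arr C" "g' \<in> Arr C"
    and "cod C f = dom C g" "cod C f' = dom C g'"
  shows "(g \<otimes> g') \<cdot> (f \<otimes> f') = (g \<cdot> f) \<otimes> (g' \<cdot> f')"
  using tensor_comp[of f "dom C f" "cod C f" g "cod C g" f' "dom C f'" "cod C f'" g' "cod C g'"] assms
  by (auto simp: hom_def)

lemma ide_tensor_ide_tensor:
  assumes "A \<in> Obj C" "B \<in> Obj C" "g \<in> Arr C"
  shows "\<one> A \<otimes> (\<one> B \<otimes> g) = \<one> (A \<otimes>\<^sub>o B) \<otimes> g"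
  using tensor_assoc[of "\<one> A" "\<one> B" g] assms by (simp add: arr_ide tensor_ide)

text \<open>
  Arrows are normalised with composites and tensor products bracketed to the right. Interchange is
  not part of this set and is applied at chosen instances.
\<close>

lemmas monoidal_simps =
  unit_obj_closed tensor_obj_closed tensor_obj_assoc tensor_obj_unit_left tensor_obj_unit_right
  tensor_assoc tensor_unit_left tensor_unit_right tensor_ide
  arr_comp arr_ide arr_tensor comp_ide_arr comp_assoc_arr dom_closed cod_closed

end

context strict_braided_monoidal_category
begin

lemma braid_unit_right:
  assumes "M \<in> Obj C"
  shows "\<c> M \<K> = \<one> M"
proof -
  have c: "\<c> M \<K> \<in> Hom M M"
    using braid_closed[OF assms unit_obj_closed] assms by (simp add: monoidal_simps)
  have idem: "\<c> M \<K> \<cdot> \<c> M \<K> = \<c> M \<K>"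
    using hexagon_right[OF assms unit_obj_closed unit_obj_closed] homD[OF c]
    by (simp add: monoidal_simps)
  obtain A B g where "\<c> M \<K> \<in> Hom A B" "g \<in> Hom B A" "g \<cdot> \<c> M \<K> = \<one> A"
    using braid_iso[OF assms unit_obj_closed] unfolding iso_def by blast
  with c have g: "g \<in> Hom M M" "g \<cdot> \<c> M \<K> = \<one> M"
    by (auto simp: hom_def)
  have "\<c> M \<K> = (g \<cdot> \<c> M \<K>) \<cdot> \<c> M \<K>"
    using c g ide_left by simp
  also have "\<dots> = g \<cdot> (\<c> M \<K> \<cdot> \<c> M \<K>)"
    using comp_assoc c g by blast
  finally show ?thesis
    using idem g by simp
qed

end

section \<open>Convolution in a Hopf algebra\<close>

context hopf_algebra
begin

abbreviation "X \<equiv> carrier_obj H"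

lemma structure_maps:
  "X \<in> Obj C" "\<eta>\<^bsub>H\<^esub> \<in> Hom \<K> X" "\<mu>\<^bsub>H\<^esub> \<in> Hom (X \<otimes>\<^sub>o X) X" "\<epsilon>\<^bsub>H\<^esub> \<in> Hom X \<K>"
  "\<delta>\<^bsub>H\<^esub> \<in> Hom X (X \<otimes>\<^sub>o X)"
  using algebra coalgebra unfolding algebra_def coalgebra_def Let_def by auto

lemmas hopf_simps = monoidal_simps structure_maps(1) homD[OF structure_maps(2)]
  homD[OF structure_maps(3)] homD[OF structure_maps(4)] homD[OF structure_maps(5)]
  homD[OF antipode_closed]

lemma unit_laws:
  "\<mu>\<^bsub>H\<^esub> \<cdot> (\<eta>\<^bsub>H\<^esub> \<otimes> \<one> X) = \<one> X" "\<mu>\<^bsub>H\<^esub> \<cdot> (\<one> X \<otimes> \<eta>\<^bsub>H\<^esub>) = \<one> X"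
  "\<mu>\<^bsub>H\<^esub> \<cdot> (\<mu>\<^bsub>H\<^esub> \<otimes> \<one> X) = \<mu>\<^bsub>H\<^esub> \<cdot> (\<one> X \<otimes> \<mu>\<^bsub>H\<^esub>)"
  using algebra unfolding algebra_def Let_def by auto

lemma counit_laws:
  "(\<epsilon>\<^bsub>H\<^esub> \<otimes> \<one> X) \<cdot> \<delta>\<^bsub>H\<^esub> = \<one> X" "(\<one> X \<otimes> \<epsilon>\<^bsub>H\<^esub>) \<cdot> \<delta>\<^bsub>H\<^esub> = \<one> X"
  "(\<delta>\<^bsub>H\<^esub> \<otimes> \<one> X) \<cdot> \<delta>\<^bsub>H\<^esub> = (\<one> X \<otimes> \<delta>\<^bsub>H\<^esub>) \<cdot> \<delta>\<^bsub>H\<^esub>"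
  using coalgebra unfolding coalgebra_def Let_def by auto

lemma counit_unit: "\<epsilon>\<^bsub>H\<^esub> \<cdot> \<eta>\<^bsub>H\<^esub> = \<one> \<K>"
  and coproduct_unit: "\<delta>\<^bsub>H\<^esub> \<cdot> \<eta>\<^bsub>H\<^esub> = \<eta>\<^bsub>H\<^esub> \<otimes> \<eta>\<^bsub>H\<^esub>"
  using unit_mor_coalgebra_morphism
  by (auto simp: coalgebra_morphism_def unit_coalgebra_def hopf_simps)

text \<open>The convolution product on the endomorphisms of the underlying object.\<close>

definition conv :: "'m \<Rightarrow> 'm \<Rightarrow> 'm" where
  "conv f g = \<mu>\<^bsub>H\<^esub> \<cdot> ((f \<otimes> g) \<cdot> \<delta>\<^bsub>H\<^esub>)"

lemma conv_assoc:
  assumes "f \<in> Hom X X" "g \<in> Hom X X" "h \<in> Hom X X"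
  shows "conv (conv f g) h = conv f (conv g h)"
proof -
  note [simp] = hopf_simps homD[OF assms(1)] homD[OF assms(2)] homD[OF assms(3)]
  have l: "conv f g \<otimes> h = (\<mu>\<^bsub>H\<^esub> \<otimes> \<one> X) \<cdot> ((f \<otimes> g \<otimes> h) \<cdot> (\<delta>\<^bsub>H\<^esub> \<otimes> \<one> X))"
    using interchange[of "\<delta>\<^bsub>H\<^esub>" "f \<otimes> g" "\<one> X" h]
      interchange[of "(f \<otimes> g) \<cdot> \<delta>\<^bsub>H\<^esub>" "\<mu>\<^bsub>H\<^esub>" h "\<one> X"]
    by (simp add: conv_def)
  have r: "f \<otimes> conv g h = (\<one> X \<otimes> \<mu>\<^bsub>H\<^esub>) \<cdot> ((f \<otimes> g \<otimes> h) \<cdot> (\<one> X \<otimes> \<delta>\<^bsub>H\<^esub>))"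
    using interchange[of "\<one> X" f "\<delta>\<^bsub>H\<^esub>" "g \<otimes> h"]
      interchange[of f "\<one> X" "(g \<otimes> h) \<cdot> \<delta>\<^bsub>H\<^esub>" "\<mu>\<^bsub>H\<^esub>"]
    by (simp add: conv_def)
  have "conv (conv f g) h
      = (\<mu>\<^bsub>H\<^esub> \<cdot> (\<mu>\<^bsub>H\<^esub> \<otimes> \<one> X)) \<cdot> ((f \<otimes> g \<otimes> h) \<cdot> ((\<delta>\<^bsub>H\<^esub> \<otimes> \<one> X) \<cdot> \<delta>\<^bsub>H\<^esub>))"
    unfolding conv_def[of "conv f g"] l by simp
  also have "\<dots> = (\<mu>\<^bsub>H\<^esub> \<cdot> (\<one> X \<otimes> \<mu>\<^bsub>H\<^esub>)) \<cdot> ((f \<otimes> g \<otimes> h) \<cdot> ((\<one> X \<otimes> \<delta>\<^bsub>H\<^esub>) \<cdot> \<delta>\<^bsub>H\<^esub>))"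
    by (simp only: unit_laws counit_laws)
  also have "\<dots> = conv f (conv g h)"
    unfolding conv_def[of f "conv g h"] r by simp
  finally show ?thesis .
qed

lemma conv_unit_right:
  assumes "f \<in> Hom X X"
  shows "conv f (\<eta>\<^bsub>H\<^esub> \<cdot> \<epsilon>\<^bsub>H\<^esub>) = f"
proof -
  note [simp] = hopf_simps homD[OF assms]
  have "f \<otimes> (\<eta>\<^bsub>H\<^esub> \<cdot> \<epsilon>\<^bsub>H\<^esub>) = (f \<otimes> \<eta>\<^bsub>H\<^esub>) \<cdot> (\<one> X \<otimes> \<epsilon>\<^bsub>H\<^esub>)"
    using interchange[of "\<one> X" f "\<epsilon>\<^bsub>H\<^esub>" "\<eta>\<^bsub>H\<^esub>"] by simp
  also have "f \<otimes> \<eta>\<^bsub>H\<^esub> = (\<one> X \<otimes> \<eta>\<^bsub>H\<^esub>) \<cdot> f"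
    using interchange[of f "\<one> X" "\<one> \<K>" "\<eta>\<^bsub>H\<^esub>"] by simp
  finally have "conv f (\<eta>\<^bsub>H\<^esub> \<cdot> \<epsilon>\<^bsub>H\<^esub>)
      = (\<mu>\<^bsub>H\<^esub> \<cdot> (\<one> X \<otimes> \<eta>\<^bsub>H\<^esub>)) \<cdot> (f \<cdot> ((\<one> X \<otimes> \<epsilon>\<^bsub>H\<^esub>) \<cdot> \<delta>\<^bsub>H\<^esub>))"
    by (simp add: conv_def)
  then show ?thesis
    by (simp only: unit_laws counit_laws) simp
qed

text \<open>A coalgebra endomorphism has its composite with the antipode as right convolution inverse.\<close>

lemma conv_antipode:
  assumes "f \<in> Hom X X" "\<epsilon>\<^bsub>H\<^esub> \<cdot> f = \<epsilon>\<^bsub>H\<^esub>" "\<delta>\<^bsub>H\<^esub> \<cdot> f = (f \<otimes> f) \<cdot> \<delta>\<^bsub>H\<^esub>"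
  shows "conv f (\<lambda>\<^sub>S\<^bsub>H\<^esub> \<cdot> f) = \<eta>\<^bsub>H\<^esub> \<cdot> \<epsilon>\<^bsub>H\<^esub>"
proof -
  note [simp] = hopf_simps homD[OF assms(1)]
  have "f \<otimes> (\<lambda>\<^sub>S\<^bsub>H\<^esub> \<cdot> f) = (\<one> X \<otimes> \<lambda>\<^sub>S\<^bsub>H\<^esub>) \<cdot> (f \<otimes> f)"
    using interchange[of f "\<one> X" f "\<lambda>\<^sub>S\<^bsub>H\<^esub>"] by simp
  then have "conv f (\<lambda>\<^sub>S\<^bsub>H\<^esub> \<cdot> f) = \<mu>\<^bsub>H\<^esub> \<cdot> ((\<one> X \<otimes> \<lambda>\<^sub>S\<^bsub>H\<^esub>) \<cdot> (\<delta>\<^bsub>H\<^esub> \<cdot> f))"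
    by (simp add: conv_def assms(3))
  also have "\<dots> = (\<mu>\<^bsub>H\<^esub> \<cdot> (\<one> X \<otimes> \<lambda>\<^sub>S\<^bsub>H\<^esub>) \<cdot> \<delta>\<^bsub>H\<^esub>) \<cdot> f"
    by simp
  also have "\<dots> = \<eta>\<^bsub>H\<^esub> \<cdot> \<epsilon>\<^bsub>H\<^esub>"
    unfolding antipode_right by (simp add: assms(2))
  finally show ?thesis .
qed

end

section \<open>The action on the unit and idempotence\<close>

context weak_twisted_post_hopf_algebra
begin

lemma m_hom: "m \<in> Hom (X \<otimes>\<^sub>o X) X"
  and counit_m: "\<epsilon>\<^bsub>H\<^esub> \<cdot> m = \<epsilon>\<^bsub>H\<^esub> \<otimes> \<epsilon>\<^bsub>H\<^esub>"
  and coproduct_m: "\<delta>\<^bsub>H\<^esub> \<cdot> m = (m \<otimes> m) \<cdot> ((\<one> X \<otimes> \<c> X X \<otimes> \<one> X) \<cdot> (\<delta>\<^bsub>H\<^esub> \<otimes> \<delta>\<^bsub>H\<^esub>))"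
  using m_coalgebra_morphism by (auto simp: coalgebra_morphism_def tensor_coalgebra_def)

lemma \<Phi>_hom: "\<Phi> \<in> Hom X X"
  using \<Phi>_coalgebra_morphism by (simp add: coalgebra_morphism_def)

lemmas post_hopf_simps = hopf_simps homD[OF m_hom] homD[OF \<Phi>_hom]
  homD[OF braid_closed[OF structure_maps(1) structure_maps(1)]]

text \<open>
  The action on the unit element, \<open>h \<mapsto> m (h, 1)\<close>; by strictness its domain \<open>X \<otimes> \<K>\<close> is \<open>X\<close>.
\<close>

definition act_unit :: "'m" where
  "act_unit = m \<cdot> (\<one> X \<otimes> \<eta>\<^bsub>H\<^esub>)"

lemma act_unit_hom: "act_unit \<in> Hom X X"
  by (simp add: act_unit_def hom_def post_hopf_simps)

text \<open>
  The composite of \<open>m \<otimes> m\<close> with the coproduct of \<open>h\<close> and two units: both \<open>\<delta> (m (h, 1))\<close> and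
  \<open>m (h, 1 \<sqdot> 1)\<close> lead to it, through \<open>\<delta> 1 = 1 \<otimes> 1\<close> and through the compatibility of \<open>m\<close> with the
  product.
\<close>

lemma diagonal_act_unit:
  "(m \<otimes> m) \<cdot> ((\<one> X \<otimes> \<c> X X \<otimes> \<one> X) \<cdot> (\<delta>\<^bsub>H\<^esub> \<otimes> (\<eta>\<^bsub>H\<^esub> \<otimes> \<eta>\<^bsub>H\<^esub>)))
    = (act_unit \<otimes> act_unit) \<cdot> \<delta>\<^bsub>H\<^esub>"
proof -
  note [simp] = post_hopf_simps
  have split: "\<delta>\<^bsub>H\<^esub> \<otimes> (\<eta>\<^bsub>H\<^esub> \<otimes> \<eta>\<^bsub>H\<^esub>) = (\<one> X \<otimes> ((\<one> X \<otimes> \<eta>\<^bsub>H\<^esub>) \<otimes> \<eta>\<^bsub>H\<^esub>)) \<cdot> \<delta>\<^bsub>H\<^esub>"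
    using interchange[of "\<delta>\<^bsub>H\<^esub>" "\<one> X \<otimes> \<one> X" "\<one> \<K>" "\<eta>\<^bsub>H\<^esub> \<otimes> \<eta>\<^bsub>H\<^esub>"]
    by (simp add: ide_tensor_ide_tensor)
  have braid: "\<c> X X \<cdot> (\<one> X \<otimes> \<eta>\<^bsub>H\<^esub>) = \<eta>\<^bsub>H\<^esub> \<otimes> \<one> X"
    using braid_natural[OF ide_closed[OF structure_maps(1)] structure_maps(2)]
    by (simp add: braid_unit_right)
  have swap: "(\<one> X \<otimes> (\<c> X X \<otimes> \<one> X)) \<cdot> (\<one> X \<otimes> ((\<one> X \<otimes> \<eta>\<^bsub>H\<^esub>) \<otimes> \<eta>\<^bsub>H\<^esub>))
      = (\<one> X \<otimes> \<eta>\<^bsub>H\<^esub>) \<otimes> (\<one> X \<otimes> \<eta>\<^bsub>H\<^esub>)"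
    using interchange[of "\<one> X" "\<one> X" "(\<one> X \<otimes> \<eta>\<^bsub>H\<^esub>) \<otimes> \<eta>\<^bsub>H\<^esub>" "\<c> X X \<otimes> \<one> X"]
      interchange[of "\<one> X \<otimes> \<eta>\<^bsub>H\<^esub>" "\<c> X X" "\<eta>\<^bsub>H\<^esub>" "\<one> X"]
    by (simp add: braid)
  have "(m \<otimes> m) \<cdot> ((\<one> X \<otimes> \<c> X X \<otimes> \<one> X) \<cdot> (\<delta>\<^bsub>H\<^esub> \<otimes> (\<eta>\<^bsub>H\<^esub> \<otimes> \<eta>\<^bsub>H\<^esub>)))
      = (m \<otimes> m) \<cdot>
        (((\<one> X \<otimes> (\<c> X X \<otimes> \<one> X)) \<cdot> (\<one> X \<otimes> ((\<one> X \<otimes> \<eta>\<^bsub>H\<^esub>) \<otimes> \<eta>\<^bsub>H\<^esub>))) \<cdot> \<delta>\<^bsub>H\<^esub>)"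
    unfolding split by simp
  also have "\<dots> = ((m \<otimes> m) \<cdot> ((\<one> X \<otimes> \<eta>\<^bsub>H\<^esub>) \<otimes> (\<one> X \<otimes> \<eta>\<^bsub>H\<^esub>))) \<cdot> \<delta>\<^bsub>H\<^esub>"
    unfolding swap by simp
  also have "\<dots> = (act_unit \<otimes> act_unit) \<cdot> \<delta>\<^bsub>H\<^esub>"
    using interchange[of "\<one> X \<otimes> \<eta>\<^bsub>H\<^esub>" m "\<one> X \<otimes> \<eta>\<^bsub>H\<^esub>" m] by (simp add: act_unit_def)
  finally show ?thesis .
qed

lemma counit_act_unit: "\<epsilon>\<^bsub>H\<^esub> \<cdot> act_unit = \<epsilon>\<^bsub>H\<^esub>"
proof -
  note [simp] = post_hopf_simps
  have "\<epsilon>\<^bsub>H\<^esub> \<cdot> act_unit = (\<epsilon>\<^bsub>H\<^esub> \<cdot> m) \<cdot> (\<one> X \<otimes> \<eta>\<^bsub>H\<^esub>)"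
    by (simp add: act_unit_def)
  also have "\<dots> = \<epsilon>\<^bsub>H\<^esub>"
    unfolding counit_m using interchange[of "\<one> X" "\<epsilon>\<^bsub>H\<^esub>" "\<eta>\<^bsub>H\<^esub>" "\<epsilon>\<^bsub>H\<^esub>"]
    by (simp add: counit_unit)
  finally show ?thesis .
qed

lemma coproduct_act_unit: "\<delta>\<^bsub>H\<^esub> \<cdot> act_unit = (act_unit \<otimes> act_unit) \<cdot> \<delta>\<^bsub>H\<^esub>"
proof -
  note [simp] = post_hopf_simps
  have "\<delta>\<^bsub>H\<^esub> \<cdot> act_unit = (\<delta>\<^bsub>H\<^esub> \<cdot> m) \<cdot> (\<one> X \<otimes> \<eta>\<^bsub>H\<^esub>)"
    by (simp add: act_unit_def)
  also have "\<dots> = (m \<otimes> m) \<cdot> ((\<one> X \<otimes> \<c> X X \<otimes> \<one> X) \<cdot> ((\<delta>\<^bsub>H\<^esub> \<otimes> \<delta>\<^bsub>H\<^esub>) \<cdot> (\<one> X \<otimes> \<eta>\<^bsub>H\<^esub>)))"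
    unfolding coproduct_m by simp
  also have "(\<delta>\<^bsub>H\<^esub> \<otimes> \<delta>\<^bsub>H\<^esub>) \<cdot> (\<one> X \<otimes> \<eta>\<^bsub>H\<^esub>) = \<delta>\<^bsub>H\<^esub> \<otimes> (\<eta>\<^bsub>H\<^esub> \<otimes> \<eta>\<^bsub>H\<^esub>)"
    using interchange[of "\<one> X" "\<delta>\<^bsub>H\<^esub>" "\<eta>\<^bsub>H\<^esub>" "\<delta>\<^bsub>H\<^esub>"] by (simp add: coproduct_unit)
  finally show ?thesis
    unfolding diagonal_act_unit .
qed

text \<open>This is \<open>m (h, 1 \<sqdot> 1) = m (h\<^sub>1, 1) \<sqdot> m (h\<^sub>2, 1)\<close>.\<close>

lemma act_unit_conv_idem: "conv act_unit act_unit = act_unit"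
proof -
  note [simp] = post_hopf_simps
  have "\<mu>\<^bsub>H\<^esub> \<cdot> (\<eta>\<^bsub>H\<^esub> \<otimes> \<eta>\<^bsub>H\<^esub>) = (\<mu>\<^bsub>H\<^esub> \<cdot> (\<one> X \<otimes> \<eta>\<^bsub>H\<^esub>)) \<cdot> \<eta>\<^bsub>H\<^esub>"
    using interchange[of "\<eta>\<^bsub>H\<^esub>" "\<one> X" "\<one> \<K>" "\<eta>\<^bsub>H\<^esub>"] by simp
  then have unit_square: "\<mu>\<^bsub>H\<^esub> \<cdot> (\<eta>\<^bsub>H\<^esub> \<otimes> \<eta>\<^bsub>H\<^esub>) = \<eta>\<^bsub>H\<^esub>"
    unfolding unit_laws by simp
  have "act_unit = (m \<cdot> (\<one> X \<otimes> \<mu>\<^bsub>H\<^esub>)) \<cdot> (\<one> X \<otimes> (\<eta>\<^bsub>H\<^esub> \<otimes> \<eta>\<^bsub>H\<^esub>))"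
    using interchange[of "\<one> X" "\<one> X" "\<eta>\<^bsub>H\<^esub> \<otimes> \<eta>\<^bsub>H\<^esub>" "\<mu>\<^bsub>H\<^esub>"]
    by (simp add: act_unit_def unit_square)
  also have "\<dots> = \<mu>\<^bsub>H\<^esub> \<cdot> ((m \<otimes> m) \<cdot> ((\<one> X \<otimes> \<c> X X \<otimes> \<one> X) \<cdot>
      ((\<delta>\<^bsub>H\<^esub> \<otimes> (\<one> X \<otimes> \<one> X)) \<cdot> (\<one> X \<otimes> (\<eta>\<^bsub>H\<^esub> \<otimes> \<eta>\<^bsub>H\<^esub>)))))"
    unfolding m_product by simp
  also have "(\<delta>\<^bsub>H\<^esub> \<otimes> (\<one> X \<otimes> \<one> X)) \<cdot> (\<one> X \<otimes> (\<eta>\<^bsub>H\<^esub> \<otimes> \<eta>\<^bsub>H\<^esub>)) = \<delta>\<^bsub>H\<^esub> \<otimes> (\<eta>\<^bsub>H\<^esub> \<otimes> \<eta>\<^bsub>H\<^esub>)"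
    using interchange[of "\<one> X" "\<delta>\<^bsub>H\<^esub>" "\<eta>\<^bsub>H\<^esub> \<otimes> \<eta>\<^bsub>H\<^esub>" "\<one> X \<otimes> \<one> X"] by simp
  finally show ?thesis
    unfolding diagonal_act_unit conv_def by simp
qed

text \<open>The action on the unit element is trivial: \<open>m (h, 1) = \<epsilon> h \<sqdot> 1\<close>.\<close>

lemma act_unit_eq: "act_unit = \<eta>\<^bsub>H\<^esub> \<cdot> \<epsilon>\<^bsub>H\<^esub>"
proof -
  let ?inv = "\<lambda>\<^sub>S\<^bsub>H\<^esub> \<cdot> act_unit"
  have inv: "conv act_unit ?inv = \<eta>\<^bsub>H\<^esub> \<cdot> \<epsilon>\<^bsub>H\<^esub>"
    using conv_antipode act_unit_hom counit_act_unit coproduct_act_unit by blast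
  have "act_unit = conv act_unit (conv act_unit ?inv)"
    by (simp add: inv conv_unit_right act_unit_hom)
  also have "\<dots> = conv (conv act_unit act_unit) ?inv"
    using conv_assoc act_unit_hom comp_closed[OF act_unit_hom antipode_closed] by simp
  also have "\<dots> = \<eta>\<^bsub>H\<^esub> \<cdot> \<epsilon>\<^bsub>H\<^esub>"
    by (simp add: act_unit_conv_idem inv)
  finally show ?thesis .
qed

text \<open>The weighted product with the unit element: \<open>\<Phi> h\<^sub>1 \<sqdot> m (h\<^sub>2, 1) = \<Phi> h\<close>.\<close>

lemma weighted_product_unit: "\<mu>\<^bsub>H\<^esub> \<cdot> ((\<Phi> \<otimes> m) \<cdot> (\<delta>\<^bsub>H\<^esub> \<otimes> \<eta>\<^bsub>H\<^esub>)) = \<Phi>"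
proof -
  note [simp] = post_hopf_simps
  have "\<delta>\<^bsub>H\<^esub> \<otimes> \<eta>\<^bsub>H\<^esub> = (\<one> X \<otimes> (\<one> X \<otimes> \<eta>\<^bsub>H\<^esub>)) \<cdot> \<delta>\<^bsub>H\<^esub>"
    using interchange[of "\<delta>\<^bsub>H\<^esub>" "\<one> X \<otimes> \<one> X" "\<one> \<K>" "\<eta>\<^bsub>H\<^esub>"]
    by (simp add: ide_tensor_ide_tensor)
  moreover have "(\<Phi> \<otimes> m) \<cdot> (\<one> X \<otimes> (\<one> X \<otimes> \<eta>\<^bsub>H\<^esub>)) = \<Phi> \<otimes> act_unit"
    using interchange[of "\<one> X" \<Phi> "\<one> X \<otimes> \<eta>\<^bsub>H\<^esub>" m] by (simp add: act_unit_def)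
  moreover have "(\<Phi> \<otimes> m) \<cdot> ((\<one> X \<otimes> (\<one> X \<otimes> \<eta>\<^bsub>H\<^esub>)) \<cdot> \<delta>\<^bsub>H\<^esub>)
      = ((\<Phi> \<otimes> m) \<cdot> (\<one> X \<otimes> (\<one> X \<otimes> \<eta>\<^bsub>H\<^esub>))) \<cdot> \<delta>\<^bsub>H\<^esub>"
    by simp
  ultimately have "\<mu>\<^bsub>H\<^esub> \<cdot> ((\<Phi> \<otimes> m) \<cdot> (\<delta>\<^bsub>H\<^esub> \<otimes> \<eta>\<^bsub>H\<^esub>)) = conv \<Phi> act_unit"
    by (simp only: conv_def)
  then show ?thesis
    by (simp add: act_unit_eq conv_unit_right[OF \<Phi>_hom])
qed

lemma \<Phi>_idempotent:
  assumes "\<Phi> \<cdot> \<eta>\<^bsub>H\<^esub> = \<eta>\<^bsub>H\<^esub>"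
  shows "\<Phi> \<cdot> \<Phi> = \<Phi>"
proof -
  note [simp] = post_hopf_simps
  have "\<Phi> \<cdot> \<Phi> = \<Phi> \<cdot> (\<mu>\<^bsub>H\<^esub> \<cdot> ((\<Phi> \<otimes> m) \<cdot> (\<delta>\<^bsub>H\<^esub> \<otimes> \<eta>\<^bsub>H\<^esub>)))"
    by (simp only: weighted_product_unit)
  also have "\<delta>\<^bsub>H\<^esub> \<otimes> \<eta>\<^bsub>H\<^esub> = (\<delta>\<^bsub>H\<^esub> \<otimes> \<one> X) \<cdot> (\<one> X \<otimes> \<eta>\<^bsub>H\<^esub>)"
    using interchange[of "\<one> X" "\<delta>\<^bsub>H\<^esub>" "\<eta>\<^bsub>H\<^esub>" "\<one> X"] by simp
  also have "\<Phi> \<cdot> (\<mu>\<^bsub>H\<^esub> \<cdot> ((\<Phi> \<otimes> m) \<cdot> ((\<delta>\<^bsub>H\<^esub> \<otimes> \<one> X) \<cdot> (\<one> X \<otimes> \<eta>\<^bsub>H\<^esub>))))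
      = (\<Phi> \<cdot> \<mu>\<^bsub>H\<^esub> \<cdot> (\<Phi> \<otimes> m) \<cdot> (\<delta>\<^bsub>H\<^esub> \<otimes> \<one> X)) \<cdot> (\<one> X \<otimes> \<eta>\<^bsub>H\<^esub>)"
    by simp
  also have "\<dots> = \<mu>\<^bsub>H\<^esub> \<cdot> ((\<Phi> \<otimes> m) \<cdot> ((\<delta>\<^bsub>H\<^esub> \<otimes> \<Phi>) \<cdot> (\<one> X \<otimes> \<eta>\<^bsub>H\<^esub>)))"
    unfolding \<Phi>_weighted_product by simp
  also have "(\<delta>\<^bsub>H\<^esub> \<otimes> \<Phi>) \<cdot> (\<one> X \<otimes> \<eta>\<^bsub>H\<^esub>) = \<delta>\<^bsub>H\<^esub> \<otimes> \<eta>\<^bsub>H\<^esub>"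
    using interchange[of "\<one> X" "\<delta>\<^bsub>H\<^esub>" "\<eta>\<^bsub>H\<^esub>" \<Phi>] by (simp add: assms)
  finally show ?thesis
    by (simp only: weighted_product_unit)
qed

end

theorem lemma3p13:
  fixes C :: "('o, 'm, 'z) braided_cat_scheme"
    and H :: "('o, 'm, 'y) hopf_alg_scheme"
    and m \<Phi> :: "'m"
  assumes "weak_twisted_post_hopf_algebra C H m \<Phi>"
    and "\<Phi> \<cdot>\<^bsub>C\<^esub> \<eta>\<^bsub>H\<^esub> = \<eta>\<^bsub>H\<^esub>"
  shows "\<Phi> \<cdot>\<^bsub>C\<^esub> \<Phi> = \<Phi>"
  using weak_twisted_post_hopf_algebra.\<Phi>_idempotent[OF assms] .

end
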